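(* Let $A,B,C,X$ be random variables with values in metric spaces $\mathcal{A},\mathcal{B},\mathcal{C},\mathcal{X}$. Assume that their joint distribution is absolutely continuous with respect to a product measure, with density denoted by $p(\cdot)$, and that the density $(a,b,c)\mapsto p(a,b,c)$ is continuous. Assume that $X \perp\!\!\!\perp A \mid (B,C)$ and $X \perp\!\!\!\perp B \mid (A,C)$. Let $c$ be such that $p(c)>0$ and let $U^c$ be the deterministic function of $(A,B)$ that indicates the equivalence class $U^c_i$ of path-connected components of $\mathrm{supp}_c(A,B)$ in which $(A,B)$ lies (see context). Then $$X \perp\!\!\!\perp (A,B) \mid C=c,\ U^c .$$ This means that $$p(x\mid a,b,c,u^c)=p(x\mid c,u^c)$$ for all $x,a,b$ with $p(a,b,c)>0$, where $u^c$ is the value of $U^c$ at $(a,b)$.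
   Context: The random variables may be multi-dimensional. $p$ denotes the joint density (with respect to a product measure; it can be e.g. a probability mass function or a probability density function), and also its marginal and conditional densities, distinguished by their arguments; e.g. $p(a,b,c)$ is the joint density of $(A,B,C)$ and $p(c)$ that of $C$. Conditional independence: $X \perp\!\!\!\perp A \mid B$ means $p(x,a\mid b)=p(x\mid b)\,p(a\mid b)$ for all $x,a,b$ with $p(b)>0$. A path in a metric space $\mathcal{S}$ is a continuous map $\lambda:[0,1]\to\mathcal{S}$; a set is path-connected if any two of its points are joined by a path inside it. For $c$ with $p(c)>0$ define the (not necessarily closed) support $\mathrm{supp}_c(A,B):=\{(a,b): p(a,b,c)>0\}$. For $M\subset\mathcal{A}\times\mathcal{B}$ let $\mathrm{proj}_A(M):=\{a\in\mathcal{A}:\exists b \text{ with }(a,b)\in M\}$ and $\mathrm{proj}_B(M):=\{b\in\mathcal{B}:\exists a\text{ with }(a,b)\in M\}$. Let $(Z^c_i)_i$ be the path-connected components of $\mathrm{supp}_c(A,B)$. Two components $Z^c_{i_1},Z^c_{i_2}$ are coordinate-wise connected if $\mathrm{proj}_A(Z^c_{i_1})\cap\mathrm{proj}_A(Z^c_{i_2})\neq\emptyset$ or $\mathrm{proj}_B(Z^c_{i_1})\cap\mathrm{proj}_B(Z^c_{i_2})\neq\emptyset$. Two components $Z^c_i,Z^c_j$ are equivalent if there is a finite sequence $Z^c_i=Z^c_{i_1},\dots,Z^c_{i_m}=Z^c_j$ in which any two neighbours are coordinate-wise connected. Each equivalence class is represented by the union of its members; these unions are denoted $(U^c_i)_i$.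 The variable $U^c$ is defined by $U^c:=i$ if $(A,B)\in U^c_i$, and $U^c:=0$ if $p(A,B,c)=0$. The case without a variable $C$ is treated as $C$ being deterministic, $p(c)=1$ for some $c$.
   Formalization: Added assumptions: the marginals p(a,b,c), and at the given c also p(b,c) and p(a,c), are finite; and whenever p(a,b,c)>0, a and b lie in the topological supports of the reference measures (the claim can fail otherwise). *)

theory Defs
  imports "HOL-Probability.Probability"
begin

text \<open>
  Marginals of a real-valued joint density \<open>q x y z\<close> of three variables, taken with respect to
  the reference measures \<open>MX\<close> and \<open>MY\<close>. They are Bochner integrals, hence \<open>0\<close> at points where
  the integrand is not integrable; integrability has to be assumed where it matters.
\<close>

definition marg_yz :: "'x measure \<Rightarrow> ('x \<Rightarrow> 'y \<Rightarrow> 'z \<Rightarrow> real) \<Rightarrow> 'y \<Rightarrow> 'z \<Rightarrow> real" where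
  "marg_yz MX q y z = (\<integral>x. q x y z \<partial>MX)"

definition marg_xz :: "'y measure \<Rightarrow> ('x \<Rightarrow> 'y \<Rightarrow> 'z \<Rightarrow> real) \<Rightarrow> 'x \<Rightarrow> 'z \<Rightarrow> real" where
  "marg_xz MY q x z = (\<integral>y. q x y z \<partial>MY)"

definition marg_z :: "'x measure \<Rightarrow> 'y measure \<Rightarrow> ('x \<Rightarrow> 'y \<Rightarrow> 'z \<Rightarrow> real) \<Rightarrow> 'z \<Rightarrow> real" where
  "marg_z MX MY q z = (\<integral>w. q (fst w) (snd w) z \<partial>(MX \<Otimes>\<^sub>M MY))"

text \<open>\<open>X \<bottom> Y | Z\<close>, i.e. \<open>p(x,y|z) = p(x|z) p(y|z)\<close> for all \<open>x, y, z\<close> with \<open>p(z) > 0\<close>.\<close>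

definition cond_indep ::
  "'x measure \<Rightarrow> 'y measure \<Rightarrow> ('x \<Rightarrow> 'y \<Rightarrow> 'z \<Rightarrow> real) \<Rightarrow> bool" where
  "cond_indep MX MY q \<longleftrightarrow>
     (\<forall>x y z. marg_z MX MY q z > 0 \<longrightarrow>
        q x y z / marg_z MX MY q z =
          (marg_xz MY q x z / marg_z MX MY q z) * (marg_yz MX q y z / marg_z MX MY q z))"

definition measure_support :: "'a::topological_space measure \<Rightarrow> 'a set" where
  "measure_support N = {x. \<forall>V. open V \<and> x \<in> V \<longrightarrow> emeasure N V > 0}"

definition path_comps :: "'a::topological_space set \<Rightarrow> 'a set set" where
  "path_comps S = {path_component_set S z | z. z \<in> S}"

definition cw_connected :: "('a \<times> 'b) set \<Rightarrow> ('a \<times> 'b) set \<Rightarrow> bool" where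
  "cw_connected Z1 Z2 \<longleftrightarrow> fst ` Z1 \<inter> fst ` Z2 \<noteq> {} \<or> snd ` Z1 \<inter> snd ` Z2 \<noteq> {}"

definition comp_equiv ::
  "('a::topological_space \<times> 'b::topological_space) set \<Rightarrow> (('a \<times> 'b) set \<times> ('a \<times> 'b) set) set" where
  "comp_equiv S =
     {(Z1, Z2). Z1 \<in> path_comps S \<and> Z2 \<in> path_comps S \<and> cw_connected Z1 Z2}\<^sup>*
       \<inter> path_comps S \<times> path_comps S"

definition U_classes ::
  "('a::topological_space \<times> 'b::topological_space) set \<Rightarrow> ('a \<times> 'b) set set" where
  "U_classes S = {\<Union>K | K. K \<in> path_comps S // comp_equiv S}"

text \<open>
  The value of the variable \<open>U\<close> at \<open>ab\<close>. The sets in \<open>U_classes S\<close> serve as their own indices.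
  They are nonempty, so \<open>{}\<close> is free to play the role of the extra value \<open>0\<close> taken outside \<open>S\<close>.
\<close>

definition U_var ::
  "('a::topological_space \<times> 'b::topological_space) set \<Rightarrow> 'a \<times> 'b \<Rightarrow> ('a \<times> 'b) set" where
  "U_var S ab = (if ab \<in> S then (THE U. U \<in> U_classes S \<and> ab \<in> U) else {})"

definition dens_abc ::
  "'x measure \<Rightarrow> ('x \<times> 'a \<times> 'b \<times> 'c \<Rightarrow> real) \<Rightarrow> 'a \<Rightarrow> 'b \<Rightarrow> 'c \<Rightarrow> real" where
  "dens_abc MX p a b c = (\<integral>x. p (x, a, b, c) \<partial>MX)"

definition supp_AB ::
  "'x measure \<Rightarrow> ('x \<times> 'a \<times> 'b \<times> 'c \<Rightarrow> real) \<Rightarrow> 'c \<Rightarrow> ('a \<times> 'b) set" where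
  "supp_AB MX p c = {(a, b). dens_abc MX p a b c > 0}"

text \<open>
  \<open>p(x,a,b,c,u)\<close> for fixed \<open>c\<close>, as a function of \<open>x\<close>, \<open>(a,b)\<close>, \<open>u\<close>. Since \<open>U\<close> is a function of
  \<open>(A,B)\<close>, this is the density of \<open>(X,A,B,C,U)\<close> with respect to the product of the reference
  measures and counting measure in the discrete argument \<open>u\<close>. It is not normalised by \<open>p(c)\<close>:
  that factor cancels in every conditional density given \<open>c\<close> and \<open>u\<close>.
\<close>

definition dens_u ::
  "'x measure \<Rightarrow> ('x \<times> 'a::topological_space \<times> 'b::topological_space \<times> 'c \<Rightarrow> real) \<Rightarrow> 'c \<Rightarrow>
   'x \<Rightarrow> 'a \<times> 'b \<Rightarrow> ('a \<times> 'b) set \<Rightarrow> real" where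
  "dens_u MX p c x ab u =
     (if U_var (supp_AB MX p c) ab = u then p (x, fst ab, snd ab, c) else 0)"

end

theory Submission
  imports Defs
begin

text \<open>
  On the support \<open>S\<close> of \<open>(A,B)\<close> given \<open>c\<close>, the two conditional independences say that
  \<open>p(x|a,b,c)\<close> depends on \<open>b\<close> only and on \<open>a\<close> only. Since \<open>S\<close> is open, every point has a
  rectangular neighbourhood in \<open>S\<close>, so \<open>p(x|a,b,c)\<close> is locally constant and hence constant on
  path components; the coordinate-wise connections then make it constant on every class.

  Path components of an open set need not be open here, but a class contains, with any of its
  points, every rectangle in \<open>S\<close> around that point. Hence it is open, and it has positive measure.
  It is also the intersection of \<open>S\<close> with the cylinder over its open projection, which makes it
  measurable for the product \<open>\<sigma>\<close>-algebra even when the spaces are not separable.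
\<close>

subsection \<open>Classes of path components\<close>

lemma path_comps_mem: "z \<in> S \<Longrightarrow> path_component_set S z \<in> path_comps S"
  unfolding path_comps_def by blast

lemma path_comps_eq:
  assumes "Z \<in> path_comps S" "z \<in> Z"
  shows "Z = path_component_set S z"
proof -
  obtain y where "Z = path_component_set S y"
    using assms(1) unfolding path_comps_def by blast
  then show ?thesis
    using assms(2) path_component_eq by metis
qed

lemma path_comps_subset: "Z \<in> path_comps S \<Longrightarrow> Z \<subseteq> S"
  unfolding path_comps_def using path_component_subset by blast

lemma mem_path_component_set: "z \<in> S \<Longrightarrow> z \<in> path_component_set S z"
  by (simp add: path_component_refl)

text \<open>The reflexive closure adds the diagonal over all sets; the intersection in
  \<open>comp_equiv\<close> cuts it back to \<open>path_comps S\<close>. Symmetry passes from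
  \<open>cw_connected\<close> to the closure.\<close>

lemma equiv_comp_equiv: "equiv (path_comps S) (comp_equiv S)"
proof (rule equivI)
  let ?R = "{(Z1, Z2). Z1 \<in> path_comps S \<and> Z2 \<in> path_comps S \<and> cw_connected Z1 Z2}"
  show "comp_equiv S \<subseteq> path_comps S \<times> path_comps S"
    unfolding comp_equiv_def by blast
  show "refl_on (path_comps S) (comp_equiv S)"
    unfolding comp_equiv_def refl_on_def by blast
  have "sym ?R"
    unfolding sym_def cw_connected_def by blast
  then have "sym (?R\<^sup>*)"
    by (rule sym_rtrancl)
  then show "sym (comp_equiv S)"
    unfolding comp_equiv_def sym_def by blast
  show "trans (comp_equiv S)"
    unfolding comp_equiv_def trans_def by (blast intro: rtrancl_trans)
qed

text \<open>Shows that the definite description in \<open>U_var\<close> is well defined: a class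
  containing \<open>z\<close> has a member containing \<open>z\<close>, and this member can only be
  the path component of \<open>z\<close>.\<close>

lemma U_var_eq:
  assumes "z \<in> S"
  shows "U_var S z = \<Union>(comp_equiv S `` {path_component_set S z})"
proof -
  let ?Z = "path_component_set S z"
  have Z: "?Z \<in> path_comps S"
    using assms by (rule path_comps_mem)
  have "(THE U. U \<in> U_classes S \<and> z \<in> U) = \<Union>(comp_equiv S `` {?Z})"
  proof (rule the_equality)
    have "comp_equiv S `` {?Z} \<in> path_comps S // comp_equiv S"
      using Z by (rule quotientI)
    moreover have "?Z \<in> comp_equiv S `` {?Z}"
      using equiv_class_self[OF equiv_comp_equiv Z] .
    ultimately show "\<Union>(comp_equiv S `` {?Z}) \<in> U_classes S \<and> z \<in> \<Union>(comp_equiv S `` {?Z})"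
      unfolding U_classes_def using mem_path_component_set[OF assms] by blast
  next
    fix U assume U: "U \<in> U_classes S \<and> z \<in> U"
    then obtain K where K: "K \<in> path_comps S // comp_equiv S" "U = \<Union>K"
      unfolding U_classes_def by blast
    with U obtain Z' where Z': "Z' \<in> K" "z \<in> Z'"
      by blast
    obtain W where W: "K = comp_equiv S `` {W}"
      using K(1) by (rule quotientE)
    have W': "(W, Z') \<in> comp_equiv S"
      using Z'(1) W by blast
    then have "Z' \<in> path_comps S"
      unfolding comp_equiv_def by blast
    then have "Z' = ?Z"
      using Z'(2) by (rule path_comps_eq)
    then have "K = comp_equiv S `` {?Z}"
      using equiv_class_eq[OF equiv_comp_equiv W'] W by simp
    then show "U = \<Union>(comp_equiv S `` {?Z})"
      using K(2) by simp
  qed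
  then show ?thesis
    using assms by (simp add: U_var_def)
qed

lemma mem_U_var: "z \<in> S \<Longrightarrow> z \<in> U_var S z"
  using equiv_class_self[OF equiv_comp_equiv path_comps_mem] mem_path_component_set
  by (subst U_var_eq) blast+

text \<open>Unions of distinct classes are disjoint, so replacing a class by the union of its
  members loses no information.\<close>

lemma U_var_eq_iff:
  assumes "y \<in> S" "z \<in> S"
  shows "U_var S y = U_var S z \<longleftrightarrow>
    (path_component_set S y, path_component_set S z) \<in> comp_equiv S"
proof
  assume "U_var S y = U_var S z"
  then have "z \<in> \<Union>(comp_equiv S `` {path_component_set S y})"
    using mem_U_var[OF assms(2)] U_var_eq[OF assms(1)] by simp
  then obtain Z where Z: "(path_component_set S y, Z) \<in> comp_equiv S" "z \<in> Z"
    by blast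
  then have "Z \<in> path_comps S"
    unfolding comp_equiv_def by blast
  then show "(path_component_set S y, path_component_set S z) \<in> comp_equiv S"
    using Z path_comps_eq by metis
next
  assume "(path_component_set S y, path_component_set S z) \<in> comp_equiv S"
  then show "U_var S y = U_var S z"
    using equiv_class_eq[OF equiv_comp_equiv] U_var_eq assms by metis
qed

lemma U_var_coordinate:
  assumes "y \<in> S" "z \<in> S" "fst y = fst z \<or> snd y = snd z"
  shows "U_var S y = U_var S z"
proof -
  have "cw_connected (path_component_set S y) (path_component_set S z)"
    using assms mem_path_component_set[OF assms(1)] mem_path_component_set[OF assms(2)]
    unfolding cw_connected_def by (metis IntI empty_iff image_eqI)
  then have "(path_component_set S y, path_component_set S z) \<in> comp_equiv S"
    using path_comps_mem[OF assms(1)] path_comps_mem[OF assms(2)]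
    unfolding comp_equiv_def by blast
  then show ?thesis
    using U_var_eq_iff assms by blast
qed

section \<open>Functions that are constant on the classes\<close>

text \<open>Induction along a chain of components: neighbours in the chain contain points that share
  a coordinate, so the constant value of \<open>h\<close> on one carries over to the next.\<close>

lemma U_var_invariant:
  assumes path: "\<And>y z. path_component S y z \<Longrightarrow> h y = h z"
    and coord: "\<And>y z. y \<in> S \<Longrightarrow> z \<in> S \<Longrightarrow> fst y = fst z \<or> snd y = snd z \<Longrightarrow> h y = h z"
    and "y \<in> S" "z \<in> S" "U_var S y = U_var S z"
  shows "h y = h z"
proof -
  let ?R = "{(Z1, Z2). Z1 \<in> path_comps S \<and> Z2 \<in> path_comps S \<and> cw_connected Z1 Z2}"
  have const: "h v = h w" if "Z \<in> path_comps S" "v \<in> Z" "w \<in> Z" for Z v w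
    using that path path_comps_eq[OF that(1,2)] by blast
  have "\<forall>v\<in>Z1. \<forall>w\<in>Z2. h v = h w" if "(Z1, Z2) \<in> ?R\<^sup>*" "Z1 \<in> path_comps S" for Z1 Z2
    using that
  proof (induction rule: rtrancl_induct)
    case base
    then show ?case using const by blast
  next
    case (step Z2 Z3)
    then obtain v w where vw: "v \<in> Z2" "w \<in> Z3" "fst v = fst w \<or> snd v = snd w"
      unfolding cw_connected_def by fastforce
    have Z: "Z2 \<in> path_comps S" "Z3 \<in> path_comps S"
      using step.hyps by auto
    then have "h v = h w"
      using coord vw path_comps_subset by blast
    then show ?case
      using step.IH step.prems const[OF Z(2) vw(2)] vw(1) by metis
  qed
  moreover have "(path_component_set S y, path_component_set S z) \<in> comp_equiv S"
    using assms U_var_eq_iff by blast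
  ultimately show ?thesis
    using mem_path_component_set[OF \<open>y \<in> S\<close>] mem_path_component_set[OF \<open>z \<in> S\<close>]
    unfolding comp_equiv_def by blast
qed

lemma coordinate_invariant_path_component:
  assumes "open S"
    and coord: "\<And>y z. y \<in> S \<Longrightarrow> z \<in> S \<Longrightarrow> fst y = fst z \<or> snd y = snd z \<Longrightarrow> h y = h z"
    and "path_component S y z"
  shows "h y = h z"
proof -
  obtain \<gamma> where \<gamma>: "path \<gamma>" "path_image \<gamma> \<subseteq> S" "pathstart \<gamma> = y" "pathfinish \<gamma> = z"
    using assms(3) unfolding path_component_def by blast
  have "\<forall>v\<in>path_image \<gamma>. eventually (\<lambda>w. h v = h w) (at v within path_image \<gamma>)"
  proof
    fix v assume "v \<in> path_image \<gamma>"
    then have "v \<in> S" using \<gamma>(2) by blast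
    obtain V W where VW: "open V" "open W" "v \<in> V \<times> W" "V \<times> W \<subseteq> S"
      using open_prod_elim[OF \<open>open S\<close> \<open>v \<in> S\<close>] .
    have "h v = h w" if "w \<in> V \<times> W" for w
    proof -
      \<comment> \<open>This corner of the rectangle shares one coordinate with \<open>v\<close> and
        the other with \<open>w\<close>, so two applications of \<open>coord\<close> give
        \<open>h v = h w\<close>.\<close>
      have "(fst v, snd w) \<in> S" "w \<in> S"
        using VW that by (auto simp: mem_Times_iff)
      then show ?thesis
        using coord[of v "(fst v, snd w)"] coord[of "(fst v, snd w)" w] \<open>v \<in> S\<close> by simp
    qed
    then show "eventually (\<lambda>w. h v = h w) (at v within path_image \<gamma>)"
      using VW unfolding eventually_at_topological by (metis open_Times)
  qed
  \<comment> \<open>A locally constant function on the connected image of the path is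
    constant.\<close>
  then show ?thesis
    using connected_local_const[OF connected_path_image[OF \<gamma>(1)]] \<gamma>
      pathstart_in_path_image pathfinish_in_path_image by metis
qed

lemma coordinate_invariant_U_var:
  assumes "open S"
    and "\<And>y z. y \<in> S \<Longrightarrow> z \<in> S \<Longrightarrow> fst y = fst z \<or> snd y = snd z \<Longrightarrow> h y = h z"
    and "y \<in> S" "z \<in> S" "U_var S y = U_var S z"
  shows "h y = h z"
proof (rule U_var_invariant[where S = S])
  show "h v = h w" if "path_component S v w" for v w
    using assms(1) _ that by (rule coordinate_invariant_path_component) (rule assms(2))
qed (rule assms(2-5); assumption?)+

section \<open>Openness and measurability of the classes\<close>

lemma U_var_empty_iff: "U_var S z = {} \<longleftrightarrow> z \<notin> S"
  using mem_U_var[of z S] by (auto simp: U_var_def)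

text \<open>Each point of a rectangle in \<open>S\<close> is linked to \<open>z\<close> through a
  corner by two moves that keep one coordinate fixed, and such moves preserve \<open>U_var\<close>.
  The product form is kept in the conclusion because the measure of a rectangle is explicit.\<close>

lemma U_var_rectangle:
  assumes "open S" "z \<in> S"
  obtains V W where "open V" "open W" "z \<in> V \<times> W" "V \<times> W \<subseteq> {y\<in>S. U_var S y = U_var S z}"
proof -
  obtain V W where VW: "open V" "open W" "z \<in> V \<times> W" "V \<times> W \<subseteq> S"
    using open_prod_elim[OF assms] .
  have "U_var S y = U_var S z" if "y \<in> V \<times> W" for y
  proof -
    have "(fst z, snd y) \<in> S" "y \<in> S"
      using VW that by (auto simp: mem_Times_iff)
    then show ?thesis
      using U_var_coordinate[of y S "(fst z, snd y)"] U_var_coordinate[of "(fst z, snd y)" S z]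
        \<open>z \<in> S\<close> by simp
  qed
  then have "V \<times> W \<subseteq> {y\<in>S. U_var S y = U_var S z}"
    using VW(4) by blast
  with VW(1-3) show thesis by (rule that)
qed

lemma open_U_var:
  assumes "open S"
  shows "open {y\<in>S. U_var S y = u}"
proof (subst open_subopen, intro ballI)
  fix z assume "z \<in> {y\<in>S. U_var S y = u}"
  then have z: "z \<in> S" "u = U_var S z" by auto
  obtain V W where VW: "open V" "open W" "z \<in> V \<times> W"
    "V \<times> W \<subseteq> {y\<in>S. U_var S y = U_var S z}"
    using U_var_rectangle[OF assms z(1)] .
  then show "\<exists>T. open T \<and> z \<in> T \<and> T \<subseteq> {y\<in>S. U_var S y = u}"
    unfolding z(2) by (intro exI[of _ "V \<times> W"] conjI open_Times)
qed

text \<open>A point of \<open>S\<close> whose first coordinate occurs in a class belongs to that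
  class by \<open>U_var_coordinate\<close>.\<close>

lemma U_var_cylinder:
  "{y\<in>S. U_var S y = u} = S \<inter> (fst ` {y\<in>S. U_var S y = u} \<times> UNIV)"
proof (intro equalityI subsetI)
  fix z assume "z \<in> S \<inter> (fst ` {y\<in>S. U_var S y = u} \<times> UNIV)"
  then obtain y where "z \<in> S" "y \<in> S" "U_var S y = u" "fst z = fst y"
    by (auto simp: mem_Times_iff)
  then show "z \<in> {y\<in>S. U_var S y = u}"
    using U_var_coordinate[of z S y] by simp
qed (auto simp: mem_Times_iff)

lemma sets_U_var:
  assumes "open S" "S \<in> sets (MA \<Otimes>\<^sub>M MB)" "sets MA = sets borel" "sets MB = sets borel"
  shows "{y\<in>S. U_var S y = u} \<in> sets (MA \<Otimes>\<^sub>M MB)"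
proof -
  have "open (fst ` {y\<in>S. U_var S y = u})"
    using open_U_var[OF assms(1)] by (rule open_image_fst)
  then have "fst ` {y\<in>S. U_var S y = u} \<times> UNIV \<in> sets (MA \<Otimes>\<^sub>M MB)"
    using assms by (intro pair_measureI) auto
  then show ?thesis
    by (subst U_var_cylinder) (use assms in auto)
qed

subsection \<open>Marginal densities\<close>

lemma integral_pos_if_pos_on:
  fixes g :: "'a \<Rightarrow> real"
  assumes "integrable N g" "\<And>y. 0 \<le> g y" "E \<in> sets N" "emeasure N E > 0" "\<And>y. y \<in> E \<Longrightarrow> g y > 0"
  shows "0 < (\<integral>y. g y \<partial>N)"
proof -
  have "(\<integral>y. g y \<partial>N) \<noteq> 0"
  proof
    assume "(\<integral>y. g y \<partial>N) = 0"
    then have "AE y in N. g y = 0"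
      using integral_nonneg_eq_0_iff_AE[OF assms(1)] assms(2) by simp
    then have "AE y in N. y \<notin> E"
      by eventually_elim (use assms(5) in force)
    then show False
      using AE_iff_null_sets[OF assms(3)] assms(4) by auto
  qed
  then show ?thesis
    using Bochner_Integration.integral_nonneg[of N g] assms(2) by (simp add: less_le)
qed

context
  fixes MX :: "'x measure" and MY :: "'y measure" and q :: "'x \<Rightarrow> 'y \<Rightarrow> 'z \<Rightarrow> real" and z :: 'z
  assumes sf: "sigma_finite_measure MX" "sigma_finite_measure MY"
    and int: "integrable (MX \<Otimes>\<^sub>M MY) (\<lambda>w. q (fst w) (snd w) z)"
begin

lemma integrable_case_prod: "integrable (MX \<Otimes>\<^sub>M MY) (\<lambda>(x, y). q x y z)"
  using int by (simp add: case_prod_beta')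

lemma integrable_marg_yz: "integrable MY (\<lambda>y. marg_yz MX q y z)"
proof -
  interpret pair_sigma_finite MX MY
    using sf by (simp add: pair_sigma_finite_def)
  show ?thesis
    unfolding marg_yz_def using integrable_snd[OF integrable_case_prod] by simp
qed

lemma marg_z_eq_integral_marg_yz: "marg_z MX MY q z = (\<integral>y. marg_yz MX q y z \<partial>MY)"
proof -
  interpret pair_sigma_finite MX MY
    using sf by (simp add: pair_sigma_finite_def)
  show ?thesis
    unfolding marg_yz_def marg_z_def using integral_snd[OF integrable_case_prod] by (simp add: case_prod_beta')
qed

lemma marg_z_pos:
  assumes "\<And>x y. 0 \<le> q x y z" "E \<in> sets MY" "emeasure MY E > 0"
    and "\<And>y. y \<in> E \<Longrightarrow> marg_yz MX q y z > 0"
  shows "marg_z MX MY q z > 0"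
  unfolding marg_z_eq_integral_marg_yz
  by (rule integral_pos_if_pos_on[OF integrable_marg_yz _ assms(2,3,4)])
    (simp add: marg_yz_def assms)

end

text \<open>Positivity at a single point says nothing about an integral. By continuity it spreads to
  an open set, which has positive measure because it contains a point of the support.\<close>

lemma marg_z_pos_if_continuous:
  fixes MY :: "'y::topological_space measure"
  assumes "sigma_finite_measure MX" "sigma_finite_measure MY"
    and "integrable (MX \<Otimes>\<^sub>M MY) (\<lambda>w. q (fst w) (snd w) z)"
    and "\<And>x y. 0 \<le> q x y z" and sets: "sets MY = sets borel"
    and cont: "continuous_on UNIV (\<lambda>y. marg_yz MX q y z)"
    and y: "marg_yz MX q y z > 0" "y \<in> measure_support MY"
  shows "marg_z MX MY q z > 0"
proof (rule marg_z_pos[where q = q and z = z, OF assms(1-4)])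
  let ?E = "{y. marg_yz MX q y z > 0}"
  have "open ?E"
    using cont by (intro open_Collect_less) auto
  then show "?E \<in> sets MY" "emeasure MY ?E > 0"
    using y sets by (auto simp: measure_support_def)
qed auto

text \<open>Clearing denominators leaves a last factor free of \<open>y\<close>. Hence the quotient
  of \<open>q x y z\<close> by \<open>marg_yz MX q y z\<close>, wherever the latter is positive,
  does not vary with \<open>y\<close>.\<close>

lemma cond_indepD:
  assumes "cond_indep MX MY q" "marg_z MX MY q z > 0"
  shows "q x y z = marg_yz MX q y z * (marg_xz MY q x z / marg_z MX MY q z)"
proof -
  have "q x y z / marg_z MX MY q z =
      (marg_xz MY q x z / marg_z MX MY q z) * (marg_yz MX q y z / marg_z MX MY q z)"
    using assms unfolding cond_indep_def by blast
  then show ?thesis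
    using assms(2) by (simp add: field_simps)
qed


section \<open>Conditional independence given the class\<close>

theorem proposition1:
  fixes M :: "'w measure"
    and X :: "'w \<Rightarrow> 'x::metric_space" and A :: "'w \<Rightarrow> 'a::metric_space"
    and B :: "'w \<Rightarrow> 'b::metric_space" and C :: "'w \<Rightarrow> 'c::metric_space"
    and MX :: "'x measure" and MA :: "'a measure" and MB :: "'b measure" and MC :: "'c measure"
    and p :: "'x \<times> 'a \<times> 'b \<times> 'c \<Rightarrow> real" and c :: 'c
  assumes "prob_space M"
    and "sets MX = sets borel" and "sets MA = sets borel"
    and "sets MB = sets borel" and "sets MC = sets borel"
    and "sigma_finite_measure MX" and "sigma_finite_measure MA"
    and "sigma_finite_measure MB" and "sigma_finite_measure MC"
    and p_nonneg: "\<And>z. 0 \<le> p z"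
    and dens: "distributed M (MX \<Otimes>\<^sub>M MA \<Otimes>\<^sub>M MB \<Otimes>\<^sub>M MC) (\<lambda>\<omega>. (X \<omega>, A \<omega>, B \<omega>, C \<omega>)) (\<lambda>z. ennreal (p z))"
    and finite_abc: "\<And>a b c'. integrable MX (\<lambda>x. p (x, a, b, c'))"
    and finite_bc: "\<And>b. integrable (MX \<Otimes>\<^sub>M MA) (\<lambda>(x, a). p (x, a, b, c))"
    and finite_ac: "\<And>a. integrable (MX \<Otimes>\<^sub>M MB) (\<lambda>(x, b). p (x, a, b, c))"
    and cont: "continuous_on UNIV (\<lambda>(a, b, c'). dens_abc MX p a b c')"
    and ref_supp: "\<And>a b. dens_abc MX p a b c > 0 \<Longrightarrow> a \<in> measure_support MA \<and> b \<in> measure_support MB"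
    and ci_A: "cond_indep MX MA (\<lambda>x a (b, c'). p (x, a, b, c'))"
    and ci_B: "cond_indep MX MB (\<lambda>x b (a, c'). p (x, a, b, c'))"
    and pc_pos: "marg_z MX (MA \<Otimes>\<^sub>M MB) (\<lambda>x (a, b) c'. p (x, a, b, c')) c > 0"
  shows "cond_indep MX (MA \<Otimes>\<^sub>M MB) (dens_u MX p c) \<and>
    (\<forall>x a b. dens_abc MX p a b c > 0 \<longrightarrow>
       (let u = U_var (supp_AB MX p c) (a, b) in
          dens_u MX p c x (a, b) u / marg_yz MX (dens_u MX p c) (a, b) u =
          marg_xz (MA \<Otimes>\<^sub>M MB) (dens_u MX p c) x u / marg_z MX (MA \<Otimes>\<^sub>M MB) (dens_u MX p c) u))"
proof -
  define g where "g = (\<lambda>a b. dens_abc MX p a b c)"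
  define S where "S = supp_AB MX p c"
  note sets = assms(2-5) and sf = assms(6-9)
  let ?MAB = "MA \<Otimes>\<^sub>M MB"
  let ?q = "dens_u MX p c"
  have mem_S: "ab \<in> S \<longleftrightarrow> g (fst ab) (snd ab) > 0" for ab
    by (cases ab) (simp add: S_def supp_AB_def g_def)
  have g_nonneg: "0 \<le> g a b" for a b
    unfolding g_def dens_abc_def using p_nonneg by simp
  have contg: "continuous_on UNIV (\<lambda>ab. g (fst ab) (snd ab))"
  proof -
    have "continuous_on UNIV (\<lambda>ab. (\<lambda>(a, b, c'). dens_abc MX p a b c') (fst ab, snd ab, c))"
      by (rule continuous_on_compose2[OF cont]) (auto intro!: continuous_intros)
    then show ?thesis by (simp add: g_def)
  qed
  have contg1: "continuous_on UNIV (\<lambda>a. g a b)" for b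
    using continuous_on_compose2[OF contg, of UNIV "\<lambda>a. (a, b)"]
    by (simp add: continuous_on_Pair)
  have contg2: "continuous_on UNIV (\<lambda>b. g a b)" for a
    using continuous_on_compose2[OF contg, of UNIV "\<lambda>b. (a, b)"]
    by (simp add: continuous_on_Pair)
  have S_eq: "S = {ab. g (fst ab) (snd ab) > 0}"
    using mem_S by blast
  have "open S"
    unfolding S_eq using contg by (auto intro!: open_Collect_less)

  \<comment> \<open>On \<open>S\<close> this is the conditional density p(x|a,b,c), with
    \<open>g\<close> as p(a,b,c).\<close>
  define k where "k = (\<lambda>x ab. p (x, fst ab, snd ab, c) / g (fst ab) (snd ab))"
  have k_snd: "k x y = k x z" if yz: "y \<in> S" "z \<in> S" "snd y = snd z" for x y z
  proof -
    let ?r = "\<lambda>x a (b, c'). p (x, a, b, c')"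
    obtain a a' b where ab: "y = (a, b)" "z = (a', b)"
      using yz(3) by (cases y, cases z) auto
    have g_eq: "marg_yz MX ?r a (b, c) = g a b" for a
      by (simp add: marg_yz_def g_def dens_abc_def)
    have pos: "g a b > 0" "g a' b > 0"
      using yz mem_S ab by auto
    \<comment> \<open>This is p(b,c) > 0, without which \<open>ci_A\<close> says nothing at
      \<open>(b, c)\<close>.\<close>
    have "marg_z MX MA ?r (b, c) > 0"
    proof (rule marg_z_pos_if_continuous[where y = a])
      show "continuous_on UNIV (\<lambda>y. marg_yz MX ?r y (b, c))"
        unfolding g_eq by (rule contg1)
      show "marg_yz MX ?r a (b, c) > 0" "a \<in> measure_support MA"
        using pos(1) ref_supp[of a b] unfolding g_eq by (simp_all add: g_def)
    qed (use sf sets p_nonneg finite_bc[of b] in \<open>simp_all add: case_prod_beta'\<close>)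
    note fact = cond_indepD[OF ci_A this]
    \<comment> \<open>Dividing the two instances by \<open>g a b\<close> and \<open>g a' b\<close>
      leaves the same factor p(x,b,c)/p(b,c).\<close>
    show ?thesis
      using fact[of x a] fact[of x a'] pos unfolding g_eq by (simp add: k_def ab)
  qed
  have k_fst: "k x y = k x z" if yz: "y \<in> S" "z \<in> S" "fst y = fst z" for x y z
  proof -
    let ?r = "\<lambda>x b (a, c'). p (x, a, b, c')"
    obtain a b b' where ab: "y = (a, b)" "z = (a, b')"
      using yz(3) by (cases y, cases z) auto
    have g_eq: "marg_yz MX ?r b (a, c) = g a b" for b
      by (simp add: marg_yz_def g_def dens_abc_def)
    have pos: "g a b > 0" "g a b' > 0"
      using yz mem_S ab by auto
    have "marg_z MX MB ?r (a, c) > 0"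
    proof (rule marg_z_pos_if_continuous[where y = b])
      show "continuous_on UNIV (\<lambda>y. marg_yz MX ?r y (a, c))"
        unfolding g_eq by (rule contg2)
      show "marg_yz MX ?r b (a, c) > 0" "b \<in> measure_support MB"
        using pos(1) ref_supp[of a b] unfolding g_eq by (simp_all add: g_def)
    qed (use sf sets p_nonneg finite_ac[of a] in \<open>simp_all add: case_prod_beta'\<close>)
    note fact = cond_indepD[OF ci_B this]
    show ?thesis
      using fact[of x b] fact[of x b'] pos unfolding g_eq by (simp add: k_def ab)
  qed
  have k_const: "k x y = k x z" if "y \<in> S" "z \<in> S" "U_var S y = U_var S z" for x y z
    by (rule coordinate_invariant_U_var[OF \<open>open S\<close> _ that]) (use k_fst k_snd in blast)

  have sfAB: "sigma_finite_measure ?MAB"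
    using sf by (intro sigma_finite_pair_measure)
  \<comment> \<open>A non-integrable function would have Bochner integral \<open>0\<close>.\<close>
  have int_p: "integrable (MX \<Otimes>\<^sub>M ?MAB) (\<lambda>w. p (fst w, fst (snd w), snd (snd w), c))"
    using pc_pos not_integrable_integral_eq unfolding marg_z_def
    by (fastforce simp: case_prod_beta')
  have int_g: "integrable ?MAB (\<lambda>ab. g (fst ab) (snd ab))"
    using integrable_marg_yz[OF sf(1) sfAB,
        where q = "\<lambda>x ab c. p (x, fst ab, snd ab, c)" and z = c] int_p
    by (simp add: marg_yz_def g_def dens_abc_def)
  have space: "space ?MAB = UNIV"
    using sets sets_eq_imp_space_eq[of MA borel] sets_eq_imp_space_eq[of MB borel]
    by (simp add: space_pair_measure)
  have "{ab \<in> space ?MAB. g (fst ab) (snd ab) > 0} \<in> sets ?MAB"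
    using borel_measurable_integrable[OF int_g] by measurable
  then have S_sets: "S \<in> sets ?MAB"
    using S_eq space by simp
  \<comment> \<open>The argument \<open>u\<close> ranges over all sets: the value \<open>{}\<close>
    gives the complement of \<open>S\<close>, any other value gives a class or nothing.\<close>
  have u_sets: "{ab. U_var S ab = u} \<in> sets ?MAB" for u
  proof (cases "u = {}")
    case True
    then have "{ab. U_var S ab = u} = space ?MAB - S"
      using U_var_empty_iff[of S] space by auto
    then show ?thesis using S_sets by auto
  next
    case False
    then have "{ab. U_var S ab = u} = {ab\<in>S. U_var S ab = u}"
      using U_var_empty_iff[of S] by auto
    then show ?thesis
      using sets_U_var[OF \<open>open S\<close> S_sets] sets by simp
  qed
  have q_eq: "?q x ab u = (if U_var S ab = u then p (x, fst ab, snd ab, c) else 0)" for x ab u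
    by (simp add: dens_u_def S_def)
  have q_nonneg: "0 \<le> ?q x ab u" for x ab u
    using p_nonneg by (simp add: q_eq)
  have yz: "marg_yz MX ?q ab u = (if U_var S ab = u then g (fst ab) (snd ab) else 0)" for ab u
    by (simp add: marg_yz_def q_eq g_def dens_abc_def)
  have int_q: "integrable (MX \<Otimes>\<^sub>M ?MAB) (\<lambda>w. ?q (fst w) (snd w) u)" for u
  proof -
    have "snd -` {ab. U_var S ab = u} \<inter> space (MX \<Otimes>\<^sub>M ?MAB) \<in> sets (MX \<Otimes>\<^sub>M ?MAB)"
      using u_sets by (rule measurable_sets[OF measurable_snd])
    \<comment> \<open>For fixed \<open>u\<close>, the function \<open>?q\<close> is the density at
      \<open>c\<close> times the indicator of a measurable set of pairs.\<close>
    from integrable_mult_indicator[OF this int_p] show ?thesis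
      by (rule Bochner_Integration.integrable_cong[THEN iffD1, rotated 2])
        (auto simp: q_eq indicator_def)
  qed
  have z_eq: "marg_z MX ?MAB ?q u = (\<integral>ab. marg_yz MX ?q ab u \<partial>?MAB)" for u
    using sf(1) sfAB int_q by (intro marg_z_eq_integral_marg_yz)
  \<comment> \<open>Each class of a point of \<open>S\<close> contains a rectangle around it whose
    sides have positive measure by \<open>ref_supp\<close>, and p(a,b,c) is positive there.\<close>
  have z_pos: "marg_z MX ?MAB ?q (U_var S ab) > 0" if ab: "ab \<in> S" for ab
  proof -
    obtain V W where VW: "open V" "open W" "ab \<in> V \<times> W"
      "V \<times> W \<subseteq> {y\<in>S. U_var S y = U_var S ab}"
      using U_var_rectangle[OF \<open>open S\<close> ab] .
    have "fst ab \<in> measure_support MA" "snd ab \<in> measure_support MB"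
      using ref_supp mem_S ab by (auto simp: g_def)
    then have "emeasure MA V > 0" "emeasure MB W > 0"
      using VW by (auto simp: measure_support_def mem_Times_iff)
    moreover have VW': "V \<in> sets MA" "W \<in> sets MB"
      using VW sets by auto
    ultimately have "emeasure ?MAB (V \<times> W) > 0"
      using sigma_finite_measure.emeasure_pair_measure_Times[OF sf(3) VW']
      by (simp add: ennreal_zero_less_mult_iff)
    moreover have "marg_yz MX ?q y (U_var S ab) > 0" if "y \<in> V \<times> W" for y
      using VW(4) that mem_S by (auto simp: yz)
    ultimately show ?thesis
      using marg_z_pos[where q = ?q and z = "U_var S ab", OF sf(1) sfAB int_q q_nonneg] VW' by blast
  qed
  \<comment> \<open>The factor \<open>k x\<close> is constant on the class and can be pulled out of
    the integral over pairs; outside the class both integrands vanish.\<close>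
  have xz: "marg_xz ?MAB ?q x (U_var S ab) = k x ab * marg_z MX ?MAB ?q (U_var S ab)"
    if "ab \<in> S" for x ab
  proof -
    have "?q x y (U_var S ab) = k x ab * marg_yz MX ?q y (U_var S ab)" for y
    proof (cases "U_var S y = U_var S ab")
      case True
      then have "y \<in> S"
        using that U_var_empty_iff by metis
      then show ?thesis
        using k_const[OF _ that True, of x] True mem_S[of y] by (simp add: q_eq yz k_def field_simps)
    qed (simp add: q_eq yz)
    then show ?thesis
      by (simp add: marg_xz_def z_eq)
  qed
  have "cond_indep MX ?MAB ?q"
    unfolding cond_indep_def
  proof (intro allI impI)
    fix x ab u assume pos: "marg_z MX ?MAB ?q u > 0"
    show "?q x ab u / marg_z MX ?MAB ?q u =
      (marg_xz ?MAB ?q x u / marg_z MX ?MAB ?q u) * (marg_yz MX ?q ab u / marg_z MX ?MAB ?q u)"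
    proof (cases "U_var S ab = u")
      case True
      \<comment> \<open>Off \<open>S\<close> the function \<open>g\<close> is zero, so the extra
        value \<open>{}\<close> has marginal zero, against \<open>pos\<close>.\<close>
      have "ab \<in> S"
      proof (rule ccontr)
        assume "ab \<notin> S"
        then have "u = {}" using True U_var_empty_iff by blast
        then have "marg_yz MX ?q y u = 0" for y
          using U_var_empty_iff[of S y] mem_S[of y] g_nonneg[of "fst y" "snd y"] by (simp add: yz)
        then show False using pos by (simp add: z_eq)
      qed
      then show ?thesis
        using xz[of ab x] True pos mem_S[of ab] by (simp add: q_eq yz k_def)
    qed (simp add: q_eq yz)
  qed
  moreover have "?q x (a, b) u / marg_yz MX ?q (a, b) u =
      marg_xz ?MAB ?q x u / marg_z MX ?MAB ?q u"
    if "dens_abc MX p a b c > 0" "u = U_var S (a, b)" for x a b u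
  proof -
    have "(a, b) \<in> S"
      using that mem_S by (simp add: g_def)
    \<comment> \<open>Both quotients equal \<open>k x (a, b)\<close>; \<open>z_pos\<close> ensures
      that the right one is not a division by zero.\<close>
    then show ?thesis
      using xz[of "(a, b)" x] z_pos[of "(a, b)"] that(2) by (simp add: q_eq yz k_def)
  qed
  ultimately show ?thesis
    unfolding Let_def S_def by blast
qed

end
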